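(* Let $\mathbf{T}=(T_1,\dots,T_n)$ be a commuting $n$-tuple of bounded linear operators on a Hilbert space $\mathcal{H}$. If $(X,\mathbf{U})$ and $(\widetilde X,\widetilde{\mathbf{U}})$ are unitary asymptotes of $\mathbf{T}$ with norm-control $1$, and $\|X\|\le1$, $\|\widetilde X\|\le1$, then $(X,\mathbf{U})\simeq(\widetilde X,\widetilde{\mathbf{U}})$; furthermore $\|X\|=1$, provided $X\ne0$.
   Context: Let $n\in\mathbb{N}$. Hilbert spaces are complex and may be $\{0\}$; $\mathcal{H}$ is separable; operators and transformations are bounded and linear. For commuting $n$-tuples $\mathbf{T}=(T_1,\dots,T_n)$ on $\mathcal{H}$ and $\widetilde{\mathbf{T}}=(\widetilde T_1,\dots,\widetilde T_n)$ on $\widetilde{\mathcal{H}}$, the intertwining set $\mathcal{I}(\mathbf{T},\widetilde{\mathbf{T}})$ consists of all bounded linear $X\colon\mathcal{H}\to\widetilde{\mathcal{H}}$ with $XT_i=\widetilde T_iX$ for $1\le i\le n$. A unitary intertwining pair of $\mathbf{T}$ is a pair $(X,\mathbf{U})$, where $\mathbf{U}=(U_1,\dots,U_n)$ is a commuting $n$-tuple of unitary operators on some Hilbert space $\mathcal{K}$ and $X\in\mathcal{I}(\mathbf{T},\mathbf{U})$. It is a unitary asymptote of $\mathbf{T}$ if for every unitary intertwining pair $(X',\mathbf{U}')$ of $\mathbf{T}$ there exists a unique $Y'\in\mathcal{I}(\mathbf{U},\mathbf{U}')$ with $X'=Y'X$. Two unitary intertwining pairs $(X,\mathbf{U})$ and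 $(\widetilde X,\widetilde{\mathbf{U}})$ of $\mathbf{T}$ are equivalent, written $(X,\mathbf{U})\simeq(\widetilde X,\widetilde{\mathbf{U}})$, if there is a unitary $Z\in\mathcal{I}(\mathbf{U},\widetilde{\mathbf{U}})$ with $\widetilde X=ZX$. A unitary asymptote $(X,\mathbf{U})$ has norm-control (with) $\kappa\in[0,\infty)$ if $\|Y'\|\le\kappa\|Y'X\|$ for every unitary intertwining pair $(Y',\mathbf{U}')$ of $\mathbf{U}$. *)

theory Defs
  imports "HOL-Analysis.Analysis" "HOL-Algebra.Module"
begin

section \<open>Complex Hilbert spaces with explicit carrier\<close>

text \<open>
  Unitary asymptotes are defined by quantifying over Hilbert spaces, so a Hilbert space must be a
  value rather than a type. It is a module record over the ring of complex numbers, together with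
  an inner product; the ring multiplication and unit of the record are junk fields. The inner
  product is linear in its first argument.
\<close>

definition complex_ring :: "complex ring" where
  "complex_ring = \<lparr>carrier = UNIV, monoid.mult = (*), one = 1, ring.zero = 0, add = (+)\<rparr>"

record 'a hilb = "(complex, 'a) module" +
  cinner :: "'a \<Rightarrow> 'a \<Rightarrow> complex"

definition hnorm :: "'a hilb \<Rightarrow> 'a \<Rightarrow> real" where
  "hnorm H x = sqrt (Re (cinner H x x))"

text \<open>
  The value off the carrier is set to 0 because the library's notion of a metric on a set requires
  symmetry and nonnegativity for all arguments.
\<close>

definition hdist :: "'a hilb \<Rightarrow> 'a \<Rightarrow> 'a \<Rightarrow> real" where
  "hdist H x y = (if x \<in> carrier H \<and> y \<in> carrier H then hnorm H (x \<ominus>\<^bsub>H\<^esub> y) else 0)"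

locale complex_inner_space = module complex_ring H for H :: "'a hilb" (structure) +
  assumes cinner_add_left:
      "\<lbrakk>x \<in> carrier H; y \<in> carrier H; z \<in> carrier H\<rbrakk>
        \<Longrightarrow> cinner H (x \<oplus> y) z = cinner H x z + cinner H y z"
    and cinner_smult_left:
      "\<lbrakk>x \<in> carrier H; y \<in> carrier H\<rbrakk> \<Longrightarrow> cinner H (c \<odot> x) y = c * cinner H x y"
    and cinner_commute:
      "\<lbrakk>x \<in> carrier H; y \<in> carrier H\<rbrakk> \<Longrightarrow> cinner H x y = cnj (cinner H y x)"
    and cinner_nonneg: "x \<in> carrier H \<Longrightarrow> 0 \<le> Re (cinner H x x)"
    and cinner_definite: "\<lbrakk>x \<in> carrier H; cinner H x x = 0\<rbrakk> \<Longrightarrow> x = \<zero>"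
begin

lemma ring_simps [simp]:
  "carrier complex_ring = UNIV" "a \<otimes>\<^bsub>complex_ring\<^esub> b = a * b" "a \<oplus>\<^bsub>complex_ring\<^esub> b = a + b"
  "\<one>\<^bsub>complex_ring\<^esub> = 1" "\<zero>\<^bsub>complex_ring\<^esub> = 0"
  by (simp_all add: complex_ring_def)

lemma smult_in [simp]: "x \<in> carrier H \<Longrightarrow> c \<odot> x \<in> carrier H"
  by (rule smult_closed) simp_all

lemma one_smult [simp]: "x \<in> carrier H \<Longrightarrow> 1 \<odot> x = x"
  using smult_one by simp

lemma zero_smult [simp]: "x \<in> carrier H \<Longrightarrow> 0 \<odot> x = \<zero>"
  using smult_l_null by simp

lemma cinner_add_right:
  assumes "x \<in> carrier H" "y \<in> carrier H" "z \<in> carrier H"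
  shows "cinner H z (x \<oplus> y) = cinner H z x + cinner H z y"
  using assms cinner_add_left cinner_commute by (metis M.add.m_closed complex_cnj_add)

lemma cinner_smult_right:
  assumes "x \<in> carrier H" "y \<in> carrier H"
  shows "cinner H y (c \<odot> x) = cnj c * cinner H y x"
  using assms cinner_smult_left cinner_commute by (metis smult_in complex_cnj_mult)

lemma cinner_zero [simp]: "x \<in> carrier H \<Longrightarrow> cinner H \<zero> x = 0"
  using cinner_add_left[of \<zero> \<zero> x] by simp

lemma Re_cinner_commute:
  "\<lbrakk>x \<in> carrier H; y \<in> carrier H\<rbrakk> \<Longrightarrow> Re (cinner H x y) = Re (cinner H y x)"
  by (subst cinner_commute) simp_all

lemma hnorm_square: "x \<in> carrier H \<Longrightarrow> (hnorm H x)\<^sup>2 = Re (cinner H x x)"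
  by (simp add: hnorm_def cinner_nonneg)

lemma hnorm_ge_0: "x \<in> carrier H \<Longrightarrow> 0 \<le> hnorm H x"
  by (simp add: hnorm_def cinner_nonneg)

lemma hnorm_eq_0_iff: "x \<in> carrier H \<Longrightarrow> hnorm H x = 0 \<longleftrightarrow> x = \<zero>"
proof
  assume x: "x \<in> carrier H" and "hnorm H x = 0"
  then have "Re (cinner H x x) = 0"
    by (simp add: hnorm_def)
  moreover have "Im (cinner H x x) = 0"
    using arg_cong[OF cinner_commute[OF x x], of Im] by simp
  ultimately show "x = \<zero>"
    using cinner_definite[OF x] by (simp add: complex_eq_iff)
qed (simp add: hnorm_def)

lemma hnorm_smult: "x \<in> carrier H \<Longrightarrow> hnorm H (c \<odot> x) = cmod c * hnorm H x"
proof -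
  assume x: "x \<in> carrier H"
  have "cinner H (c \<odot> x) (c \<odot> x) = (c * cnj c) * cinner H x x"
    using x by (simp add: cinner_smult_left cinner_smult_right)
  also have "c * cnj c = of_real ((cmod c)\<^sup>2)"
    by (rule complex_norm_square[symmetric])
  finally have "Re (cinner H (c \<odot> x) (c \<odot> x)) = (cmod c)\<^sup>2 * Re (cinner H x x)"
    by simp
  then show ?thesis
    by (simp add: hnorm_def real_sqrt_mult)
qed

lemma hnorm_add_square:
  assumes "x \<in> carrier H" "y \<in> carrier H"
  shows "(hnorm H (x \<oplus> y))\<^sup>2 = (hnorm H x)\<^sup>2 + 2 * Re (cinner H x y) + (hnorm H y)\<^sup>2"
  using assms Re_cinner_commute[of x y]
  by (simp add: hnorm_square cinner_add_left cinner_add_right)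

lemma Cauchy_Schwarz_Re:
  assumes x: "x \<in> carrier H" and y: "y \<in> carrier H"
  shows "Re (cinner H x y) \<le> hnorm H x * hnorm H y"
proof (cases "y = \<zero>")
  case True
  then show ?thesis
    using x Re_cinner_commute[OF x, of \<zero>] by (simp add: hnorm_def)
next
  case False
  define a r b where "a = (hnorm H x)\<^sup>2" and "r = Re (cinner H x y)" and "b = (hnorm H y)\<^sup>2"
  have b: "b > 0"
    using False y by (simp add: b_def hnorm_eq_0_iff)
  define t where "t = - r / b"
  have "0 \<le> (hnorm H (x \<oplus> complex_of_real t \<odot> y))\<^sup>2"
    by simp
  also have "\<dots> = a + 2 * t * r + t\<^sup>2 * b"
    using x y by (simp add: hnorm_add_square hnorm_smult cinner_smult_right a_def r_def b_def
        power_mult_distrib)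
  also have "\<dots> = a - r\<^sup>2 / b"
    using b by (simp add: t_def power2_eq_square field_simps)
  finally have "r\<^sup>2 \<le> a * b"
    using b by (simp add: field_simps)
  then have "r\<^sup>2 \<le> (hnorm H x * hnorm H y)\<^sup>2"
    by (simp add: a_def b_def power_mult_distrib)
  then show ?thesis
    unfolding r_def using x y by (meson hnorm_ge_0 mult_nonneg_nonneg power2_le_imp_le)
qed

lemma hnorm_triangle:
  assumes x: "x \<in> carrier H" and y: "y \<in> carrier H"
  shows "hnorm H (x \<oplus> y) \<le> hnorm H x + hnorm H y"
proof (rule power2_le_imp_le)
  show "(hnorm H (x \<oplus> y))\<^sup>2 \<le> (hnorm H x + hnorm H y)\<^sup>2"
    using Cauchy_Schwarz_Re[OF x y] by (simp add: hnorm_add_square[OF x y] power2_sum)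
qed (simp add: x y hnorm_ge_0)

lemma hdist_commute: "hdist H x y = hdist H y x"
proof (cases "x \<in> carrier H \<and> y \<in> carrier H")
  case True
  then have "x \<ominus> y = (-1) \<odot> (y \<ominus> x)"
  proof -
    have "(-1) \<odot> (y \<ominus> x) \<oplus> (y \<ominus> x) = \<zero>"
      using True smult_l_distr[of "-1" 1 "y \<ominus> x"] by simp
    then have "(-1) \<odot> (y \<ominus> x) = \<ominus> (y \<ominus> x)"
      using True by (simp add: M.minus_equality)
    then show ?thesis
      using True by (simp add: a_minus_def M.minus_add M.a_comm)
  qed
  then show ?thesis
    using True by (simp add: hdist_def hnorm_smult)
qed (auto simp: hdist_def)

lemma hdist_triangle:
  assumes "x \<in> carrier H" "y \<in> carrier H" "z \<in> carrier H"
  shows "hdist H x z \<le> hdist H x y + hdist H y z"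
proof -
  have "(x \<ominus> y) \<oplus> (y \<ominus> z) = x \<ominus> z"
    using assms by (simp add: a_minus_def M.a_assoc) (metis M.a_assoc M.a_inv_closed M.l_neg M.l_zero)
  then show ?thesis
    using assms hnorm_triangle[of "x \<ominus> y" "y \<ominus> z"] by (simp add: hdist_def)
qed

sublocale metric: Metric_space "carrier H" "hdist H"
proof
  fix x y
  show "0 \<le> hdist H x y"
    by (simp add: hdist_def hnorm_ge_0)
  show "hdist H x y = hdist H y x"
    by (rule hdist_commute)
  show "hdist H x y = 0 \<longleftrightarrow> x = y" if "x \<in> carrier H" "y \<in> carrier H"
    using that by (simp add: hdist_def hnorm_eq_0_iff) (metis M.add.inv_inv M.a_inv_closed M.minus_eq
        M.minus_equality M.r_neg)
qed (rule hdist_triangle)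

end

locale hilbert_space = complex_inner_space +
  assumes complete: "Metric_space.mcomplete (carrier H) (hdist H)"

definition separable_hilbert_space :: "'a hilb \<Rightarrow> bool" where
  "separable_hilbert_space H \<longleftrightarrow>
    hilbert_space H \<and> separable_space (Metric_space.mtopology (carrier H) (hdist H))"


section \<open>Bounded operators\<close>

text \<open>
  Operators are extensional functions on the carrier, so that equality of operators is equality of
  functions; accordingly the product of operators is the restricted composition \<^const>\<open>compose\<close>.
\<close>

definition bounded_operators :: "'a hilb \<Rightarrow> 'b hilb \<Rightarrow> ('a \<Rightarrow> 'b) set" where
  "bounded_operators H K =
    {X. X \<in> carrier H \<rightarrow>\<^sub>E carrier K \<and>
      (\<forall>x\<in>carrier H. \<forall>y\<in>carrier H. X (x \<oplus>\<^bsub>H\<^esub> y) = X x \<oplus>\<^bsub>K\<^esub> X y) \<and>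
      (\<forall>c. \<forall>x\<in>carrier H. X (c \<odot>\<^bsub>H\<^esub> x) = c \<odot>\<^bsub>K\<^esub> X x) \<and>
      (\<exists>C. \<forall>x\<in>carrier H. hnorm K (X x) \<le> C * hnorm H x)}"

definition opnorm :: "'a hilb \<Rightarrow> 'b hilb \<Rightarrow> ('a \<Rightarrow> 'b) \<Rightarrow> real" where
  "opnorm H K X = (SUP x\<in>{x \<in> carrier H. hnorm H x \<le> 1}. hnorm K (X x))"

definition zero_operator :: "'a hilb \<Rightarrow> 'b hilb \<Rightarrow> 'a \<Rightarrow> 'b" where
  "zero_operator H K = (\<lambda>x\<in>carrier H. \<zero>\<^bsub>K\<^esub>)"

definition unitary_operator :: "'a hilb \<Rightarrow> 'b hilb \<Rightarrow> ('a \<Rightarrow> 'b) \<Rightarrow> bool" where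
  "unitary_operator H K U \<longleftrightarrow>
    U \<in> bounded_operators H K \<and> U ` carrier H = carrier K \<and>
    (\<forall>x\<in>carrier H. \<forall>y\<in>carrier H. cinner K (U x) (U y) = cinner H x y)"


section \<open>Unitary asymptotes of commuting tuples\<close>

text \<open>An \<open>n\<close>-tuple of operators is a family of which only the values at \<open>1, \<dots>, n\<close> are used.\<close>

definition commuting_tuple :: "nat \<Rightarrow> 'a hilb \<Rightarrow> (nat \<Rightarrow> 'a \<Rightarrow> 'a) \<Rightarrow> bool" where
  "commuting_tuple n H T \<longleftrightarrow>
    (\<forall>i\<in>{1..n}. T i \<in> bounded_operators H H) \<and>
    (\<forall>i\<in>{1..n}. \<forall>j\<in>{1..n}. compose (carrier H) (T i) (T j) = compose (carrier H) (T j) (T i))"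

definition intertwiners ::
    "nat \<Rightarrow> 'a hilb \<Rightarrow> (nat \<Rightarrow> 'a \<Rightarrow> 'a) \<Rightarrow> 'b hilb \<Rightarrow> (nat \<Rightarrow> 'b \<Rightarrow> 'b) \<Rightarrow> ('a \<Rightarrow> 'b) set" where
  "intertwiners n H T K S =
    {X \<in> bounded_operators H K.
      \<forall>i\<in>{1..n}. compose (carrier H) X (T i) = compose (carrier H) (S i) X}"

definition unitary_intertwining_pair ::
    "nat \<Rightarrow> 'a hilb \<Rightarrow> (nat \<Rightarrow> 'a \<Rightarrow> 'a) \<Rightarrow> 'b hilb \<Rightarrow> ('a \<Rightarrow> 'b) \<Rightarrow> (nat \<Rightarrow> 'b \<Rightarrow> 'b) \<Rightarrow> bool" where
  "unitary_intertwining_pair n H T K X U \<longleftrightarrow>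
    hilbert_space K \<and> commuting_tuple n K U \<and> (\<forall>i\<in>{1..n}. unitary_operator K K (U i)) \<and>
    X \<in> intertwiners n H T K U"

text \<open>
  In the next two definitions \<open>K'\<close> ranges over all Hilbert spaces whose carrier is a subset of the
  type \<open>'b\<close>, which also hosts \<open>K\<close>; HOL cannot quantify over types inside a formula. As \<open>'b\<close> is a
  type variable, it may be taken as large as desired, and a result assuming these properties for a
  particular \<open>'b\<close> assumes no more than the properties for all Hilbert spaces.
\<close>

definition unitary_asymptote ::
    "nat \<Rightarrow> 'a hilb \<Rightarrow> (nat \<Rightarrow> 'a \<Rightarrow> 'a) \<Rightarrow> 'b hilb \<Rightarrow> ('a \<Rightarrow> 'b) \<Rightarrow> (nat \<Rightarrow> 'b \<Rightarrow> 'b) \<Rightarrow> bool" where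
  "unitary_asymptote n H T K X U \<longleftrightarrow>
    unitary_intertwining_pair n H T K X U \<and>
    (\<forall>(K' :: 'b hilb) X' U'. unitary_intertwining_pair n H T K' X' U' \<longrightarrow>
      (\<exists>!Y'. Y' \<in> intertwiners n K U K' U' \<and> X' = compose (carrier H) Y' X))"

definition norm_control ::
    "nat \<Rightarrow> 'a hilb \<Rightarrow> 'b hilb \<Rightarrow> ('a \<Rightarrow> 'b) \<Rightarrow> (nat \<Rightarrow> 'b \<Rightarrow> 'b) \<Rightarrow> real \<Rightarrow> bool" where
  "norm_control n H K X U \<kappa> \<longleftrightarrow>
    0 \<le> \<kappa> \<and>
    (\<forall>(K' :: 'b hilb) Y' U'. unitary_intertwining_pair n K U K' Y' U' \<longrightarrow>
      opnorm K K' Y' \<le> \<kappa> * opnorm H K' (compose (carrier H) Y' X))"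

definition equivalent_pairs ::
    "nat \<Rightarrow> 'a hilb \<Rightarrow> 'b hilb \<Rightarrow> ('a \<Rightarrow> 'b) \<Rightarrow> (nat \<Rightarrow> 'b \<Rightarrow> 'b) \<Rightarrow>
      'c hilb \<Rightarrow> ('a \<Rightarrow> 'c) \<Rightarrow> (nat \<Rightarrow> 'c \<Rightarrow> 'c) \<Rightarrow> bool" where
  "equivalent_pairs n H K X U L Y V \<longleftrightarrow>
    (\<exists>Z \<in> intertwiners n K U L V. unitary_operator K L Z \<and> Y = compose (carrier H) Z X)"

end

theory Submission
  imports Defs
begin

text \<open>
  The universal properties factor each asymptote through the other; by uniqueness of the
  factorization the two connecting operators are mutually inverse, and norm-control makes both of
  them contractions. A contraction with contractive inverse is a surjective isometry, hence unitary
  by polarization. Norm-control applied to the identity gives \<open>1 \<le> \<parallel>X\<parallel>\<close>.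
\<close>

lemma bounded_operator_in:
  "\<lbrakk>X \<in> bounded_operators H K; x \<in> carrier H\<rbrakk> \<Longrightarrow> X x \<in> carrier K"
  by (auto simp: bounded_operators_def)

text \<open>The supremum over the unit ball controls every vector: a vector of positive norm is
  rescaled to norm 1, estimated there, and scaled back by homogeneity.\<close>

lemma hnorm_bounded_operator_le:
  assumes "complex_inner_space H" "complex_inner_space K"
    and X: "X \<in> bounded_operators H K" and x: "x \<in> carrier H"
  shows "hnorm K (X x) \<le> opnorm H K X * hnorm H x"
proof -
  interpret H: complex_inner_space H by fact
  interpret K: complex_inner_space K by fact
  have smult: "X (c \<odot>\<^bsub>H\<^esub> y) = c \<odot>\<^bsub>K\<^esub> X y" if "y \<in> carrier H" for c y
    using X that by (auto simp: bounded_operators_def)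
  obtain C where C: "\<And>y. y \<in> carrier H \<Longrightarrow> hnorm K (X y) \<le> C * hnorm H y"
    using X unfolding bounded_operators_def by blast
  \<comment> \<open>A real \<open>SUP\<close> bounds its members only if the set is known to be
    bounded above.\<close>
  have bdd: "bdd_above ((\<lambda>y. hnorm K (X y)) ` {y \<in> carrier H. hnorm H y \<le> 1})"
  proof (rule bdd_aboveI2)
    fix y assume y: "y \<in> {y \<in> carrier H. hnorm H y \<le> 1}"
    have "hnorm K (X y) \<le> C * hnorm H y"
      using C y by simp
    \<comment> \<open>\<open>C\<close> may be negative when the space is {0}, hence the absolute
      value.\<close>
    also have "\<dots> \<le> \<bar>C\<bar> * 1"
      using y H.hnorm_ge_0 by (intro mult_mono) auto
    finally show "hnorm K (X y) \<le> \<bar>C\<bar>"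
      by simp
  qed
  show ?thesis
  proof (cases "hnorm H x = 0")
    case True
    then show ?thesis
      using C[OF x] by simp
  next
    case False
    then have pos: "hnorm H x > 0"
      using H.hnorm_ge_0[OF x] by simp
    define y where "y = complex_of_real (inverse (hnorm H x)) \<odot>\<^bsub>H\<^esub> x"
    have "y \<in> carrier H" "hnorm H y \<le> 1"
      using x pos by (simp_all add: y_def H.hnorm_smult norm_inverse del: of_real_inverse)
    then have "hnorm K (X y) \<le> opnorm H K X"
      unfolding opnorm_def using bdd by (intro cSUP_upper) auto
    moreover have "hnorm K (X y) = inverse (hnorm H x) * hnorm K (X x)"
      using x pos bounded_operator_in[OF X x]
      by (simp add: y_def smult K.hnorm_smult del: of_real_inverse)
    ultimately show ?thesis
      using pos by (simp add: field_simps)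
  qed
qed

text \<open>Polarization: expanding the squared norm of a sum recovers the real part of the inner
  product, and multiplying one argument by \<open>\<i>\<close> turns the imaginary part into a real
  part.\<close>

lemma norm_preserving_imp_cinner_preserving:
  assumes "complex_inner_space H" "complex_inner_space K"
    and Y: "Y \<in> bounded_operators H K"
    and iso: "\<And>x. x \<in> carrier H \<Longrightarrow> hnorm K (Y x) = hnorm H x"
    and x: "x \<in> carrier H" and y: "y \<in> carrier H"
  shows "cinner K (Y x) (Y y) = cinner H x y"
proof -
  interpret H: complex_inner_space H by fact
  interpret K: complex_inner_space K by fact
  have add: "Y (u \<oplus>\<^bsub>H\<^esub> v) = Y u \<oplus>\<^bsub>K\<^esub> Y v" if "u \<in> carrier H" "v \<in> carrier H" for u v
    using Y that by (auto simp: bounded_operators_def)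
  have smult: "Y (c \<odot>\<^bsub>H\<^esub> u) = c \<odot>\<^bsub>K\<^esub> Y u" if "u \<in> carrier H" for c u
    using Y that by (auto simp: bounded_operators_def)
  have Re: "Re (cinner K (Y u) (Y v)) = Re (cinner H u v)"
    if u: "u \<in> carrier H" and v: "v \<in> carrier H" for u v
  proof -
    have "hnorm K (Y u \<oplus>\<^bsub>K\<^esub> Y v) = hnorm H (u \<oplus>\<^bsub>H\<^esub> v)"
      using iso[of "u \<oplus>\<^bsub>H\<^esub> v"] u v by (simp add: add)
    then show ?thesis
      using H.hnorm_add_square[OF u v]
        K.hnorm_add_square[OF bounded_operator_in[OF Y u] bounded_operator_in[OF Y v]]
      by (simp add: iso u v)
  qed
  \<comment> \<open>Uses \<open>Re (\<i> * z) = - Im z\<close> and linearity of the inner product in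
    its first argument.\<close>
  have "Im (cinner K (Y x) (Y y)) = Im (cinner H x y)"
    using Re[of "\<i> \<odot>\<^bsub>H\<^esub> x" y] x y bounded_operator_in[OF Y]
    by (simp add: smult H.cinner_smult_left K.cinner_smult_left)
  with Re[OF x y] show ?thesis
    by (rule complex_eqI)
qed

lemma contraction_with_contractive_inverse_unitary:
  assumes H: "complex_inner_space H" and K: "complex_inner_space K"
    and Y: "Y \<in> bounded_operators H K" and Z: "Z \<in> bounded_operators K H"
    and ZY: "\<And>x. x \<in> carrier H \<Longrightarrow> Z (Y x) = x" and YZ: "\<And>y. y \<in> carrier K \<Longrightarrow> Y (Z y) = y"
    and norms: "opnorm H K Y \<le> 1" "opnorm K H Z \<le> 1"
  shows "unitary_operator H K Y"
proof -
  \<comment> \<open>Stated over fresh types so that it serves both \<open>Y\<close> and the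
    oppositely directed \<open>Z\<close>.\<close>
  have contr: "hnorm M (S x) \<le> hnorm L x"
    if "complex_inner_space L" "complex_inner_space M" "S \<in> bounded_operators L M"
      "opnorm L M S \<le> 1" "x \<in> carrier L"
    for L :: "'c hilb" and M :: "'d hilb" and S x
    using hnorm_bounded_operator_le[OF that(1-3,5)] that(4)
      mult_right_mono[OF that(4) complex_inner_space.hnorm_ge_0[OF that(1,5)]] by simp
  \<comment> \<open>The sandwich is \<open>hnorm H x = hnorm H (Z (Y x)) \<le> hnorm K (Y x) \<le>
    hnorm H x\<close>.\<close>
  have "hnorm K (Y x) = hnorm H x" if x: "x \<in> carrier H" for x
    using contr[OF H K Y norms(1) x] contr[OF K H Z norms(2) bounded_operator_in[OF Y x]]
    by (simp add: ZY x)
  then have "\<forall>x\<in>carrier H. \<forall>y\<in>carrier H. cinner K (Y x) (Y y) = cinner H x y"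
    using norm_preserving_imp_cinner_preserving[OF H K Y] by blast
  moreover have "Y ` carrier H = carrier K"
    using bounded_operator_in[OF Y] bounded_operator_in[OF Z] YZ by (metis imageI image_subsetI
        subsetI subset_antisym)
  ultimately show ?thesis
    using Y by (simp add: unitary_operator_def)
qed

lemma bounded_operator_compose:
  assumes "complex_inner_space H" "complex_inner_space K" "complex_inner_space L"
    and X: "X \<in> bounded_operators H K" and Y: "Y \<in> bounded_operators K L"
  shows "compose (carrier H) Y X \<in> bounded_operators H L"
proof -
  interpret H: complex_inner_space H by fact
  interpret K: complex_inner_space K by fact
  obtain C where C: "\<And>x. x \<in> carrier H \<Longrightarrow> hnorm K (X x) \<le> C * hnorm H x"
    using X unfolding bounded_operators_def by blast
  obtain D where D: "\<And>x. x \<in> carrier K \<Longrightarrow> hnorm L (Y x) \<le> D * hnorm K x"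
    using Y unfolding bounded_operators_def by blast
  have "hnorm L (Y (X x)) \<le> (\<bar>D\<bar> * C) * hnorm H x" if x: "x \<in> carrier H" for x
  proof -
    have Xx: "X x \<in> carrier K"
      using bounded_operator_in[OF X x] .
    have "hnorm L (Y (X x)) \<le> D * hnorm K (X x)"
      using D[OF Xx] .
    \<comment> \<open>The factor must be nonnegative before the bound for \<open>X\<close> is
      inserted under it.\<close>
    also have "\<dots> \<le> \<bar>D\<bar> * hnorm K (X x)"
      using K.hnorm_ge_0[OF Xx] by (simp add: mult_right_mono)
    also have "\<dots> \<le> \<bar>D\<bar> * (C * hnorm H x)"
      using C[OF x] by (simp add: mult_left_mono)
    finally show ?thesis
      by (simp add: mult.assoc)
  qed
  then have "\<exists>C. \<forall>x\<in>carrier H. hnorm L (Y (X x)) \<le> C * hnorm H x"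
    by blast
  then show ?thesis
    using X Y by (auto simp: bounded_operators_def compose_def PiE_iff)
qed

text \<open>Restricted compositions agree off the carrier, where both are \<open>undefined\<close>,
  so the intertwining relation can be checked pointwise on the carrier.\<close>

lemma intertwiners_iff:
  "X \<in> intertwiners n H T K S \<longleftrightarrow>
    X \<in> bounded_operators H K \<and> (\<forall>i\<in>{1..n}. \<forall>x\<in>carrier H. X (T i x) = S i (X x))"
  by (auto simp: intertwiners_def compose_def fun_eq_iff restrict_def)

lemma intertwiners_compose:
  assumes "complex_inner_space H" "complex_inner_space K" "complex_inner_space L"
    and X: "X \<in> intertwiners n H T K S" and Y: "Y \<in> intertwiners n K S L R"
    and T: "\<forall>i\<in>{1..n}. T i \<in> bounded_operators H H"
  shows "compose (carrier H) Y X \<in> intertwiners n H T L R"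
  using X Y T bounded_operator_compose[OF assms(1-3)] bounded_operator_in[of X H K]
    bounded_operator_in[of "T _" H H]
  by (simp add: intertwiners_iff compose_def)

lemma identity_intertwiner:
  assumes "complex_inner_space K" and U: "\<forall>i\<in>{1..n}. U i \<in> bounded_operators K K"
  shows "(\<lambda>x\<in>carrier K. x) \<in> intertwiners n K U K U"
proof -
  interpret K: complex_inner_space K by fact
  have "(\<lambda>x\<in>carrier K. x) \<in> bounded_operators K K"
    by (auto simp: bounded_operators_def intro: exI[of _ 1])
  then show ?thesis
    using U bounded_operator_in[of "U _" K K] by (simp add: intertwiners_iff)
qed

text \<open>The asymptote is tested against itself: \<open>W\<close> and the identity both factor
  \<open>X\<close> through \<open>X\<close>, and such a factorization is unique. This will show that
  the two connecting operators are mutually inverse.\<close>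

lemma unitary_asymptote_endomorphism_eq_identity:
  assumes asym: "unitary_asymptote n H T K X U"
    and W: "W \<in> intertwiners n K U K U" and fix_X: "\<And>x. x \<in> carrier H \<Longrightarrow> W (X x) = X x"
  shows "W = (\<lambda>x\<in>carrier K. x)"
proof -
  have pair: "unitary_intertwining_pair n H T K X U"
    using asym by (simp add: unitary_asymptote_def)
  then have K: "complex_inner_space K" and U: "\<forall>i\<in>{1..n}. U i \<in> bounded_operators K K"
    and X: "X \<in> bounded_operators H K"
    by (auto simp: unitary_intertwining_pair_def hilbert_space_def commuting_tuple_def
        intertwiners_def)
  have ext: "X \<in> extensional (carrier H)"
    using X by (simp add: bounded_operators_def PiE_def)
  have "X = compose (carrier H) W X"
    using fix_X ext by (auto intro!: extensionalityI)(simp add: compose_def)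
  moreover have "X = compose (carrier H) (\<lambda>x\<in>carrier K. x) X"
    using bounded_operator_in[OF X] ext by (auto intro!: extensionalityI)(simp add: compose_def)
  moreover have "\<exists>!Y. Y \<in> intertwiners n K U K U \<and> X = compose (carrier H) Y X"
    using asym pair by (simp add: unitary_asymptote_def)
  ultimately show ?thesis
    using W identity_intertwiner[OF K U] by blast
qed

text \<open>The identity of \<open>K\<close> together with \<open>U\<close> is a unitary
  intertwining pair of \<open>U\<close>, and composing it with \<open>X\<close> gives
  \<open>X\<close> back, so norm-control bounds the norm of the identity by that of
  \<open>X\<close>.\<close>

lemma norm_control_imp_opnorm_ge_1:
  assumes H: "complex_inner_space H" and pair: "unitary_intertwining_pair n H T K X U"
    and ctrl: "norm_control n H K X U 1" and nz: "X \<noteq> zero_operator H K"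
  shows "1 \<le> opnorm H K X"
proof -
  define I where "I = (\<lambda>x\<in>carrier K. x)"
  have K: "complex_inner_space K" and U: "\<forall>i\<in>{1..n}. U i \<in> bounded_operators K K"
    and X: "X \<in> bounded_operators H K"
    using pair by (auto simp: unitary_intertwining_pair_def hilbert_space_def commuting_tuple_def
        intertwiners_def)
  interpret K: complex_inner_space K by (rule K)
  have I: "I \<in> intertwiners n K U K U"
    unfolding I_def by (rule identity_intertwiner[OF K U])
  have ext: "X \<in> extensional (carrier H)"
    using X by (simp add: bounded_operators_def PiE_def)
  \<comment> \<open>On the space {0} the identity has norm 0; a nonzero value of \<open>X\<close>
    rules this case out.\<close>
  have "\<exists>x\<in>carrier H. X x \<noteq> \<zero>\<^bsub>K\<^esub>"
  proof (rule ccontr)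
    assume "\<not> ?thesis"
    then have "X = zero_operator H K"
      unfolding zero_operator_def using ext by (intro extensionalityI[of X "carrier H"]) auto
    with nz show False ..
  qed
  then obtain x where x: "x \<in> carrier H" "X x \<noteq> \<zero>\<^bsub>K\<^esub>" by blast
  have Xx: "X x \<in> carrier K"
    using bounded_operator_in[OF X x(1)] .
  then have "hnorm K (X x) > 0"
    using x K.hnorm_ge_0 K.hnorm_eq_0_iff by (simp add: order_less_le)
  \<comment> \<open>The identity is evaluated at the nonzero vector \<open>X x\<close>, whose
    positive norm then cancels.\<close>
  moreover have "hnorm K (X x) \<le> opnorm K K I * hnorm K (X x)"
    using hnorm_bounded_operator_le[OF K K _ Xx, of I] I Xx by (simp add: intertwiners_def I_def)
  ultimately have "1 \<le> opnorm K K I"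
    by simp
  also have "unitary_intertwining_pair n K U K I U"
    using pair I by (simp add: unitary_intertwining_pair_def)
  then have "opnorm K K I \<le> opnorm H K (compose (carrier H) I X)"
    using ctrl unfolding norm_control_def by fastforce
  also have "compose (carrier H) I X = X"
    using bounded_operator_in[OF X] ext
    by (intro extensionalityI[of _ "carrier H"]) (auto simp: compose_def I_def)
  finally show ?thesis .
qed

theorem proposition6:
  fixes n :: nat
    and H :: "'a hilb" and T :: "nat \<Rightarrow> 'a \<Rightarrow> 'a"
    and K :: "'b hilb" and X :: "'a \<Rightarrow> 'b" and U :: "nat \<Rightarrow> 'b \<Rightarrow> 'b"
    and K' :: "'b hilb" and X' :: "'a \<Rightarrow> 'b" and U' :: "nat \<Rightarrow> 'b \<Rightarrow> 'b"
  assumes "separable_hilbert_space H"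
    and "commuting_tuple n H T"
    and "unitary_asymptote n H T K X U" and "norm_control n H K X U 1"
    and "unitary_asymptote n H T K' X' U'" and "norm_control n H K' X' U' 1"
    and "opnorm H K X \<le> 1" and "opnorm H K' X' \<le> 1"
  shows "equivalent_pairs n H K X U K' X' U' \<and>
    (X \<noteq> zero_operator H K \<longrightarrow> opnorm H K X = 1)"
proof -
  have pair: "unitary_intertwining_pair n H T K X U" "unitary_intertwining_pair n H T K' X' U'"
    using assms(3,5) by (simp_all add: unitary_asymptote_def)
  have H: "complex_inner_space H"
    using assms(1) by (simp add: separable_hilbert_space_def hilbert_space_def)
  have K: "complex_inner_space K" "complex_inner_space K'"
    and U: "\<forall>i\<in>{1..n}. U i \<in> bounded_operators K K" "\<forall>i\<in>{1..n}. U' i \<in> bounded_operators K' K'"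
    using pair by (auto simp: unitary_intertwining_pair_def hilbert_space_def commuting_tuple_def)
  obtain Y where Y: "Y \<in> intertwiners n K U K' U'" "X' = compose (carrier H) Y X"
    using assms(3) pair(2) unfolding unitary_asymptote_def by blast
  obtain Z where Z: "Z \<in> intertwiners n K' U' K U" "X = compose (carrier H) Z X'"
    using assms(5) pair(1) unfolding unitary_asymptote_def by blast
  have YX: "Y (X x) = X' x" and ZX: "Z (X' x) = X x" if "x \<in> carrier H" for x
    using fun_cong[OF Y(2), of x] fun_cong[OF Z(2), of x] that by (simp_all add: compose_def)
  have inX: "X x \<in> carrier K" "X' x \<in> carrier K'" if "x \<in> carrier H" for x
    using pair that bounded_operator_in
    by (fastforce simp: unitary_intertwining_pair_def intertwiners_def)+
  \<comment> \<open>\<open>Z\<close> after \<open>Y\<close> fixes the range of \<open>X\<close>,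
    since \<open>Z (Y (X x)) = Z (X' x) = X x\<close>.\<close>
  have "compose (carrier K) Z Y = (\<lambda>x\<in>carrier K. x)"
    using intertwiners_compose[OF K(1,2,1) Y(1) Z(1) U(1)]
    by (rule unitary_asymptote_endomorphism_eq_identity[OF assms(3)])
      (simp add: compose_def inX YX ZX)
  then have ZY: "Z (Y x) = x" if "x \<in> carrier K" for x
    using that by (metis compose_eq restrict_apply')
  have "compose (carrier K') Y Z = (\<lambda>x\<in>carrier K'. x)"
    using intertwiners_compose[OF K(2,1,2) Z(1) Y(1) U(2)]
    by (rule unitary_asymptote_endomorphism_eq_identity[OF assms(5)])
      (simp add: compose_def inX YX ZX)
  then have YZ: "Y (Z x) = x" if "x \<in> carrier K'" for x
    using that by (metis compose_eq restrict_apply')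
  \<comment> \<open>Each connecting operator is itself an admissible test for norm-control: the norm
    of \<open>Y\<close> is at most that of \<open>Y\<close> after \<open>X\<close>, which is
    \<open>X'\<close>, hence at most 1. The bound for \<open>Z\<close> is symmetric.\<close>
  have "unitary_intertwining_pair n K U K' Y U'" "unitary_intertwining_pair n K' U' K Z U"
    using pair Y(1) Z(1) by (simp_all add: unitary_intertwining_pair_def)
  then have "opnorm K K' Y \<le> 1" "opnorm K' K Z \<le> 1"
    using assms(4,6,7,8) Y(2)[symmetric] Z(2)[symmetric]
    unfolding norm_control_def by fastforce+
  then have "unitary_operator K K' Y"
    using contraction_with_contractive_inverse_unitary[OF K _ _ ZY YZ] Y(1) Z(1)
    by (simp add: intertwiners_def)
  then have "equivalent_pairs n H K X U K' X' U'"
    unfolding equivalent_pairs_def using Y by blast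
  moreover have "opnorm H K X = 1" if "X \<noteq> zero_operator H K"
    using norm_control_imp_opnorm_ge_1[OF H pair(1) assms(4) that] assms(7) by simp
  ultimately show ?thesis
    by blast
qed

end
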